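(* Let $D\ge 1$ and let $H_0,H_1,\dots,H_M$ be Hermitian $D\times D$ complex matrices. Let $H(t)=\sum_{m=0}^M h_m(t)H_m$, where the $h_m:[0,\infty)\to\mathbb{R}$ are bounded and $H(t)$ is a piecewise continuous function of $t$. Let $U(t)$ be the unitary solution of $i\frac{d}{dt}U(t)=H(t)U(t)$, $U(0)=I$. Then for every $T\ge 0$ there exists a Hermitian matrix $C[T]$ such that $e^{-iC[T]}=U(T)$, $\; iC[T]\in\mathcal{L}(\{iH_m\})$, and $$\|C[T]\|_F\le\int_0^T\|H(t)\|_F\,dt .$$
   Context: $\|A\|_F=\sqrt{\operatorname{tr}A^\dagger A}$ is the Frobenius norm. $\mathcal{L}(\{iH_m\})$ denotes the dynamical Lie algebra: the smallest real vector space of $D\times D$ complex matrices containing $iH_0,\dots,iH_M$ and closed under real linear combinations and commutators $[X,Y]=XY-YX$. *)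

theory Defs
  imports "HOL-Analysis.Analysis"
begin

type_synonym 'n cmat = "complex^'n^'n"

definition cscale :: "complex \<Rightarrow> ('n::finite) cmat \<Rightarrow> 'n cmat" where
  "cscale c A = (\<chi> i j. c * A$i$j)"

definition adj :: "('n::finite) cmat \<Rightarrow> 'n cmat" where
  "adj A = (\<chi> i j. cnj (A$j$i))"

definition hermitian :: "('n::finite) cmat \<Rightarrow> bool" where
  "hermitian A \<longleftrightarrow> adj A = A"

text \<open>Frobenius norm ||A||_F = sqrt (tr (A^dagger A)); the trace is real and nonnegative.\<close>
definition frob :: "('n::finite) cmat \<Rightarrow> real" where
  "frob A = sqrt (Re (trace (adj A ** A)))"

fun mpow :: "('n::finite) cmat \<Rightarrow> nat \<Rightarrow> 'n cmat" where
  "mpow A 0 = mat 1"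
| "mpow A (Suc k) = A ** mpow A k"

definition mexp :: "('n::finite) cmat \<Rightarrow> 'n cmat" where
  "mexp A = (\<Sum>k. (1 / fact k) *\<^sub>R mpow A k)"

definition commutator :: "('n::finite) cmat \<Rightarrow> 'n cmat \<Rightarrow> 'n cmat" where
  "commutator X Y = X ** Y - Y ** X"

inductive_set dla :: "('n::finite) cmat set \<Rightarrow> 'n cmat set" for S where
  gen: "X \<in> S \<Longrightarrow> X \<in> dla S"
| zero: "0 \<in> dla S"
| add: "X \<in> dla S \<Longrightarrow> Y \<in> dla S \<Longrightarrow> X + Y \<in> dla S"
| scale: "X \<in> dla S \<Longrightarrow> r *\<^sub>R X \<in> dla S"
| bracket: "X \<in> dla S \<Longrightarrow> Y \<in> dla S \<Longrightarrow> commutator X Y \<in> dla S"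

definition piecewise_continuous_nonneg :: "(real \<Rightarrow> 'a::topological_space) \<Rightarrow> bool" where
  "piecewise_continuous_nonneg f \<longleftrightarrow>
     (\<forall>T\<ge>0. \<exists>S. finite S \<and> continuous_on ({0..T} - S) f \<and>
        (\<forall>s\<in>S. (\<exists>l. (f \<longlongrightarrow> l) (at s within {0..<s})) \<and>
                 (\<exists>l. (f \<longlongrightarrow> l) (at s within {s<..T}))))"

end

theory Submission
  imports Defs
begin

text \<open>
  The Frobenius norm is the Euclidean norm on matrices and is invariant under multiplication by
  unitaries. Let \<open>L\<close> be the dynamical Lie algebra; it consists of skew-Hermitian matrices.
  Cutting \<open>[0,T]\<close> into \<open>n\<close> equal intervals and exponentiating the integrals of \<open>-iH\<close> over them gives a
  product \<open>g\<close> of exponentials of elements of \<open>L\<close> with \<open>g = U(T) + O(1/n)\<close> whose exponents have total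
  norm at most \<open>\<integral>\<parallel>H\<parallel>\<close>.

  To merge a product of exponentials \<open>exp(w\<^sub>i X\<^sub>i)\<close> with \<open>\<parallel>X\<^sub>i\<parallel> \<le> 1\<close> and \<open>W = \<Sum>w\<^sub>i\<close> into one
  exponential, minimise \<open>\<Sum>w\<^sub>i\<parallel>Y\<^sub>i\<parallel>\<^sup>2 + K\<parallel>P - g\<parallel>\<^sup>2\<close> over \<open>Y\<^sub>i \<in> L\<close>, where \<open>P\<close> is the product of the
  \<open>exp(w\<^sub>i Y\<^sub>i)\<close>. If the \<open>w\<^sub>i\<close> are small, the first variation says that every \<open>Y\<^sub>i\<close> is the conjugate,
  by the partial product before it, of the single element \<open>Q = -K proj\<^sub>L(P\<^sup>*(P - g))\<close>; inductively all
  \<open>Y\<^sub>i = Q\<close>. So \<open>P = exp(WQ)\<close>, and comparing with the energy of the original product,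
  \<open>\<parallel>WQ\<parallel> \<le> W\<close> and \<open>K\<parallel>exp(WQ) - g\<parallel>\<^sup>2 \<le> W\<close>. Letting \<open>K\<close> and \<open>n\<close> tend to infinity, a limit point of
  the exponents in the closed space \<open>L\<close> is the required generator. No closedness of the group
  generated by \<open>exp L\<close> is needed.
\<close>

section \<open>Frobenius inner product and unitary matrices\<close>

lemma inner_cmat: "inner A B = Re (trace (adj A ** B))"
  for A B :: "('n::finite) cmat"
  unfolding inner_vec_def trace_def adj_def matrix_matrix_mult_def
  by (simp add: inner_complex_def) (rule sum.swap)

lemma frob_eq_norm: "frob A = norm A"
  by (simp add: frob_def norm_eq_sqrt_inner inner_cmat)

lemma adj_matrix_mult: "adj (A ** B) = adj B ** adj A"
  by (simp add: adj_def matrix_matrix_mult_def vec_eq_iff mult.commute)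

lemma adj_adj [simp]: "adj (adj A) = A"
  by (simp add: adj_def)

lemma adj_add: "adj (A + B) = adj A + adj B"
  by (simp add: adj_def vec_eq_iff)

lemma adj_scaleR: "adj (r *\<^sub>R A) = r *\<^sub>R adj A"
  by (simp add: adj_def vec_eq_iff)

lemma adj_zero [simp]: "adj 0 = 0"
  by (simp add: adj_def vec_eq_iff)

lemma adj_one [simp]: "adj (mat 1) = mat 1"
  by (auto simp: adj_def mat_def vec_eq_iff)

lemma bounded_linear_adj: "bounded_linear (adj :: ('n::finite) cmat \<Rightarrow> _)"
  by (intro linearI adj_add adj_scaleR linear_conv_bounded_linear[THEN iffD1])

lemma inner_matrix_mult_left: "inner (X ** A) B = inner A (adj X ** B)"
  for X A B :: "('n::finite) cmat"
  by (simp add: inner_cmat adj_matrix_mult matrix_mul_assoc)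

lemma inner_matrix_mult_right: "inner (A ** X) B = inner A (B ** adj X)"
  for X A B :: "('n::finite) cmat"
  unfolding inner_cmat adj_matrix_mult
  by (metis matrix_mul_assoc trace_mul_sym)

text \<open>Cauchy-Schwarz bounds each squared entry by a row sum of \<open>A\<close> times a column
  sum of \<open>B\<close>; summing over all entries factorises.\<close>

lemma norm_matrix_mult_le: "norm (A ** B) \<le> norm A * norm B"
  for A B :: "('n::finite) cmat"
proof -
  have sq: "(norm X)\<^sup>2 = (\<Sum>i\<in>UNIV. \<Sum>j\<in>UNIV. (cmod (X$i$j))\<^sup>2)" for X :: "'n cmat"
    by (simp add: power2_norm_eq_inner inner_vec_def)
  have entry: "(cmod ((A ** B)$i$j))\<^sup>2 \<le> (\<Sum>k\<in>UNIV. (cmod (A$i$k))\<^sup>2) * (\<Sum>k\<in>UNIV. (cmod (B$k$j))\<^sup>2)" for i j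
  proof -
    have "cmod ((A ** B)$i$j) \<le> (\<Sum>k\<in>UNIV. cmod (A$i$k) * cmod (B$k$j))"
      unfolding matrix_matrix_mult_def by (simp add: sum_norm_le norm_mult)
    then have "(cmod ((A ** B)$i$j))\<^sup>2 \<le> (\<Sum>k\<in>UNIV. cmod (A$i$k) * cmod (B$k$j))\<^sup>2"
      by (rule power_mono) simp
    also have "\<dots> \<le> (\<Sum>k\<in>UNIV. (cmod (A$i$k))\<^sup>2) * (\<Sum>k\<in>UNIV. (cmod (B$k$j))\<^sup>2)"
      by (rule Cauchy_Schwarz_ineq_sum)
    finally show ?thesis .
  qed
  have "(norm (A ** B))\<^sup>2 \<le> (\<Sum>i\<in>UNIV. \<Sum>j\<in>UNIV. (\<Sum>k\<in>UNIV. (cmod (A$i$k))\<^sup>2) * (\<Sum>k\<in>UNIV. (cmod (B$k$j))\<^sup>2))"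
    unfolding sq by (intro sum_mono entry)
  also have "\<dots> = (norm A)\<^sup>2 * (\<Sum>j\<in>UNIV. \<Sum>k\<in>UNIV. (cmod (B$k$j))\<^sup>2)"
    unfolding sq by (simp only: sum_distrib_left[symmetric] sum_distrib_right[symmetric])
  also have "\<dots> = (norm A * norm B)\<^sup>2"
    unfolding sq[of B] power_mult_distrib by (subst sum.swap) (rule refl)
  finally show ?thesis
    by (rule power2_le_imp_le) simp
qed

lemma bounded_bilinear_matrix_mult:
  "bounded_bilinear ((**) :: ('n::finite) cmat \<Rightarrow> 'n cmat \<Rightarrow> 'n cmat)"
proof
  fix A A' B B' :: "'n cmat" and r :: real
  show "(A + A') ** B = A ** B + A' ** B"
    by (simp add: matrix_matrix_mult_def vec_eq_iff distrib_right sum.distrib)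
  show "A ** (B + B') = A ** B + A ** B'"
    by (rule matrix_add_ldistrib)
  show "(r *\<^sub>R A) ** B = r *\<^sub>R (A ** B)" "A ** (r *\<^sub>R B) = r *\<^sub>R (A ** B)"
    by (simp_all add: matrix_matrix_mult_def vec_eq_iff scaleR_right.sum)
  show "\<exists>K. \<forall>A B :: 'n cmat. norm ((A :: 'n cmat) ** B) \<le> norm A * norm B * K"
    by (intro exI[of _ 1]) (auto simp: norm_matrix_mult_le)
qed

interpretation mm: bounded_bilinear "(**) :: ('n::finite) cmat \<Rightarrow> 'n cmat \<Rightarrow> 'n cmat"
  by (rule bounded_bilinear_matrix_mult)

definition unitary :: "('n::finite) cmat \<Rightarrow> bool" where
  "unitary U \<longleftrightarrow> adj U ** U = mat 1"

lemma unitary_right: "unitary U \<Longrightarrow> U ** adj U = mat 1"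
  unfolding unitary_def using matrix_left_right_inverse by blast

lemma unitary_mult: "unitary U \<Longrightarrow> unitary V \<Longrightarrow> unitary (U ** V)"
  unfolding unitary_def adj_matrix_mult by (metis matrix_mul_assoc matrix_mul_lid)

lemma norm_unitary_left: "unitary U \<Longrightarrow> norm (U ** A) = norm A"
  for A U :: "('n::finite) cmat"
  by (simp add: norm_eq_sqrt_inner inner_matrix_mult_left unitary_def matrix_mul_assoc)

lemma norm_unitary_right: "unitary U \<Longrightarrow> norm (A ** U) = norm A"
  for A U :: "('n::finite) cmat"
  by (simp add: norm_eq_sqrt_inner inner_matrix_mult_right unitary_right flip: matrix_mul_assoc)

definition skew :: "('n::finite) cmat \<Rightarrow> bool" where
  "skew A \<longleftrightarrow> adj A = - A"

lemma skew_scaleR: "skew A \<Longrightarrow> skew (r *\<^sub>R A)"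
  by (simp add: skew_def adj_scaleR)

lemma skew_add: "skew A \<Longrightarrow> skew B \<Longrightarrow> skew (A + B)"
  by (simp add: skew_def adj_add)

section \<open>The matrix exponential\<close>

lemma mpow_scaleR: "mpow (t *\<^sub>R A) k = t ^ k *\<^sub>R mpow A k"
  by (induction k) (simp_all add: mm.scaleR_left mm.scaleR_right mult.commute)

lemma norm_mpow_le:
  fixes A :: "('n::finite) cmat"
  shows "norm (mpow A k) \<le> norm (mat 1 :: 'n cmat) * norm A ^ k"
proof (induction k)
  case (Suc k)
  have "norm (mpow A (Suc k)) \<le> norm A * norm (mpow A k)"
    by (simp add: norm_matrix_mult_le)
  also have "\<dots> \<le> norm A * (norm (mat 1 :: 'n cmat) * norm A ^ k)"
    by (intro mult_left_mono Suc) simp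
  finally show ?case by (simp add: mult_ac)
qed simp

lemma summable_mexp: "summable (\<lambda>k. (1 / fact k) *\<^sub>R mpow A k)"
  for A :: "('n::finite) cmat"
proof (rule summable_comparison_test')
  show "summable (\<lambda>k. norm (mat 1 :: 'n cmat) * (norm A ^ k /\<^sub>R fact k))"
    by (intro summable_mult summable_exp_generic)
  show "norm ((1 / fact k) *\<^sub>R mpow A k) \<le> norm (mat 1 :: 'n cmat) * (norm A ^ k /\<^sub>R fact k)" for k
    using norm_mpow_le[of A k] by (simp add: divide_simps)
qed

lemma mexp_zero [simp]: "mexp 0 = mat 1"
proof -
  have "(1 / fact k) *\<^sub>R mpow 0 k = (if k = 0 then mat 1 else 0 :: 'a cmat)" for k
    by (cases k) (simp_all add: mm.zero_left)
  then show ?thesis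
    unfolding mexp_def by (simp add: sums_unique[OF sums_single, symmetric])
qed

lemma mpow_commute: "B ** A = A ** B \<Longrightarrow> B ** mpow A k = mpow A k ** B"
  by (induction k) (simp, metis mpow.simps(2) matrix_mul_assoc)

lemma mexp_commute:
  assumes "B ** A = A ** B" shows "B ** mexp A = mexp A ** B"
proof -
  have "B ** mexp A = (\<Sum>k. B ** ((1 / fact k) *\<^sub>R mpow A k))"
    unfolding mexp_def by (rule bounded_linear.suminf[OF mm.bounded_linear_right summable_mexp])
  also have "\<dots> = (\<Sum>k. ((1 / fact k) *\<^sub>R mpow A k) ** B)"
    by (simp add: mm.scaleR_left mm.scaleR_right mpow_commute[OF assms])
  also have "\<dots> = mexp A ** B"
    unfolding mexp_def by (rule bounded_linear.suminf[OF mm.bounded_linear_left summable_mexp, symmetric])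
  finally show ?thesis .
qed

lemma adj_mpow: "adj (mpow A k) = mpow (adj A) k"
  by (induction k) (simp_all add: adj_matrix_mult mpow_commute)

lemma adj_mexp: "adj (mexp A) = mexp (adj A)"
proof -
  have "adj (mexp A) = (\<Sum>k. adj ((1 / fact k) *\<^sub>R mpow A k))"
    unfolding mexp_def by (rule bounded_linear.suminf[OF bounded_linear_adj summable_mexp])
  then show ?thesis
    by (simp add: mexp_def adj_scaleR adj_mpow)
qed

lemma mexp_sums: "(\<lambda>k. (1 / fact k) *\<^sub>R mpow A k) sums mexp A"
  unfolding mexp_def by (rule summable_sums[OF summable_mexp])

text \<open>Along the real line every entry of the exponential is a power series with complex
  coefficients, so termwise differentiation applies; the index shift in \<open>diffs\<close>
  produces the factor \<open>A\<close>.\<close>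

lemma mexp_scaleR_entry_has_field_derivative:
  fixes A :: "('n::finite) cmat" and i j :: 'n
  defines "F \<equiv> \<lambda>z::complex. \<Sum>k. (mpow A k $ i $ j / fact k) * z ^ k"
  shows "F (complex_of_real t) = mexp (t *\<^sub>R A) $ i $ j"
    and "(F has_field_derivative (A ** mexp (t *\<^sub>R A)) $ i $ j) (at (complex_of_real t))"
proof -
  have bl: "bounded_linear (\<lambda>X::'n cmat. X $ i $ j)"
    by (intro bounded_linear_compose[OF bounded_linear_vec_nth bounded_linear_vec_nth])
  have scale: "(1 / fact k) *\<^sub>R (s ^ k *\<^sub>R x) = x / fact k * complex_of_real s ^ k" for s k and x :: complex
    by (simp add: scaleR_conv_of_real)
  have real_sum: "(\<lambda>k. (mpow A k $ i $ j / fact k) * complex_of_real s ^ k) sums (mexp (s *\<^sub>R A) $ i $ j)" for s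
    using bounded_linear.sums[OF bl mexp_sums[of "s *\<^sub>R A"]]
    unfolding mpow_scaleR vector_scaleR_component scale .
  show "F (complex_of_real t) = mexp (t *\<^sub>R A) $ i $ j"
    unfolding F_def using real_sum[of t] by (simp add: sums_iff)
  have "(F has_field_derivative (\<Sum>k. diffs (\<lambda>k. mpow A k $ i $ j / fact k) k * of_real t ^ k)) (at (of_real t))"
    unfolding F_def
  proof (rule termdiffs_strong)
    \<comment> \<open>Termwise differentiation at \<open>t\<close> needs convergence at a point of
      larger modulus; one unit further out is such a point.\<close>
    show "summable (\<lambda>k. (mpow A k $ i $ j / fact k) * complex_of_real (\<bar>t\<bar> + 1) ^ k)"
      by (rule sums_summable[OF real_sum])
    show "norm (complex_of_real t) < norm (complex_of_real (\<bar>t\<bar> + 1))"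
      unfolding norm_of_real by simp
  qed
  moreover have "(\<lambda>k. diffs (\<lambda>k. mpow A k $ i $ j / fact k) k * complex_of_real t ^ k) sums ((A ** mexp (t *\<^sub>R A)) $ i $ j)"
  proof -
    have "diffs (\<lambda>k. mpow A k $ i $ j / fact k) k = (A ** mpow A k) $ i $ j / fact k" for k
      unfolding diffs_def fact_Suc mpow.simps by (simp del: of_nat_Suc)
    then show ?thesis
      using bounded_linear.sums[OF bounded_linear_compose[OF bl mm.bounded_linear_right[of A]]
          mexp_sums[of "t *\<^sub>R A"]]
      unfolding mpow_scaleR mm.scaleR_right vector_scaleR_component scale by simp
  qed
  ultimately show "(F has_field_derivative (A ** mexp (t *\<^sub>R A)) $ i $ j) (at (complex_of_real t))"
    by (simp add: sums_iff)
qed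

lemma mexp_scaleR_has_vector_derivative:
  fixes A :: "('n::finite) cmat"
  shows "((\<lambda>t. mexp (t *\<^sub>R A)) has_vector_derivative A ** mexp (t *\<^sub>R A)) (at t within S)"
proof -
  have entry: "((\<lambda>t. mexp (t *\<^sub>R A) $ i $ j) has_vector_derivative (A ** mexp (t *\<^sub>R A)) $ i $ j) (at t within S)" for i j
    using has_vector_derivative_real_field[OF mexp_scaleR_entry_has_field_derivative(2)[of A i j t]]
    unfolding mexp_scaleR_entry_has_field_derivative(1) .
  show ?thesis
    unfolding has_vector_derivative_def
  proof (rule has_derivative_componentwise_within[THEN iffD2], rule ballI)
    fix b :: "'n cmat" assume "b \<in> Basis"
    then obtain i j c where "b = axis i (axis j c)"
      unfolding Basis_vec_def by blast
    then show "((\<lambda>x. mexp (x *\<^sub>R A) \<bullet> b) has_derivative (\<lambda>x. (x *\<^sub>R (A ** mexp (t *\<^sub>R A))) \<bullet> b)) (at t within S)"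
      using has_derivative_inner_left[OF entry[of i j, unfolded has_vector_derivative_def], of c]
      by (simp add: inner_axis)
  qed
qed

lemma mexp_scaleR_chain_has_vector_derivative [derivative_intros]:
  fixes A :: "('n::finite) cmat"
  assumes "(f has_real_derivative f') (at t within S)"
  shows "((\<lambda>t. mexp (f t *\<^sub>R A)) has_vector_derivative f' *\<^sub>R (A ** mexp (f t *\<^sub>R A))) (at t within S)"
  using vector_diff_chain_within[OF _ mexp_scaleR_has_vector_derivative, of f f' t S A] assms
  by (simp add: has_real_derivative_iff_has_vector_derivative o_def)

text \<open>The auxiliary \<open>F\<close> has derivative zero because \<open>A\<close> commutes
  with its own exponentials; its values at \<open>a\<close> and at \<open>0\<close> are the two
  sides.\<close>

lemma mexp_add_scaleR:
  fixes A :: "('n::finite) cmat"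
  shows "mexp (a *\<^sub>R A) ** mexp (b *\<^sub>R A) = mexp ((a + b) *\<^sub>R A)"
proof -
  define F where "F t = mexp (t *\<^sub>R A) ** mexp ((a + b - t) *\<^sub>R A)" for t :: real
  have com: "A ** mexp (s *\<^sub>R A) = mexp (s *\<^sub>R A) ** A" for s :: real
    by (rule mexp_commute) (simp add: mm.scaleR_left mm.scaleR_right)
  have "(F has_vector_derivative 0) (at t within UNIV)" for t
    unfolding F_def
    by (rule has_vector_derivative_eq_rhs, rule mm.has_vector_derivative,
        (rule mexp_scaleR_chain_has_vector_derivative derivative_eq_intros refl)+)
      (simp add: com mm.minus_right flip: matrix_mul_assoc)
  then obtain c where "\<And>t. F t = c"
    using has_vector_derivative_zero_constant[of UNIV F] by auto
  then have "F a = F 0" by metis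
  then show ?thesis by (simp add: F_def)
qed

lemma mexp_minus_mult: "mexp (- A) ** mexp A = mat 1" "mexp A ** mexp (- A) = mat 1"
  using mexp_add_scaleR[of "-1" A 1] mexp_add_scaleR[of 1 A "-1"] by simp_all

lemma unitary_mexp: "skew A \<Longrightarrow> unitary (mexp A)"
  by (simp add: unitary_def skew_def adj_mexp mexp_minus_mult)

lemma continuous_on_mexp_scaleR [continuous_intros]:
  fixes A :: "('n::finite) cmat"
  assumes "continuous_on S f"
  shows "continuous_on S (\<lambda>t. mexp (f t *\<^sub>R A))"
proof -
  have "continuous_on UNIV (\<lambda>t. mexp (t *\<^sub>R A))"
    by (rule continuous_on_vector_derivative[OF mexp_scaleR_has_vector_derivative])
  then show ?thesis
    by (rule continuous_on_compose2[OF _ assms]) simp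
qed

section \<open>Duhamel's formula and the derivative of the exponential\<close>

text \<open>Duhamel's formula, from the fundamental theorem of calculus along a path from
  \<open>mexp A\<close> to \<open>mexp B\<close>; the two matrices may fail to commute.\<close>

lemma mexp_diff_has_integral:
  fixes A B :: "('n::finite) cmat"
  shows "((\<lambda>u. mexp ((1 - u) *\<^sub>R A) ** (B - A) ** mexp (u *\<^sub>R B)) has_integral (mexp B - mexp A)) {0..1}"
proof -
  define F where "F u = mexp ((1 - u) *\<^sub>R A) ** mexp (u *\<^sub>R B)" for u :: real
  have com: "A ** mexp (s *\<^sub>R A) = mexp (s *\<^sub>R A) ** A" for s :: real
    by (rule mexp_commute) (simp add: mm.scaleR_left mm.scaleR_right)
  have "(F has_vector_derivative mexp ((1 - u) *\<^sub>R A) ** (B - A) ** mexp (u *\<^sub>R B)) (at u within {0..1})" for u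
    unfolding F_def
    by (rule has_vector_derivative_eq_rhs, rule mm.has_vector_derivative,
        (rule mexp_scaleR_chain_has_vector_derivative derivative_eq_intros refl)+)
      (simp add: com mm.minus_left mm.diff_left mm.diff_right matrix_mul_assoc)
  then have "((\<lambda>u. mexp ((1 - u) *\<^sub>R A) ** (B - A) ** mexp (u *\<^sub>R B)) has_integral (F 1 - F 0)) {0..1}"
    by (intro fundamental_theorem_of_calculus) auto
  then show ?thesis by (simp add: F_def)
qed

text \<open>For skew arguments both exponential factors in Duhamel's formula are unitary, so the
  integrand has constant norm.\<close>

lemma norm_mexp_diff_le:
  assumes "skew A" "skew B"
  shows "norm (mexp B - mexp A) \<le> norm (B - A)"
proof -
  have "norm (mexp B - mexp A) \<le> norm (B - A) * measure lborel (cbox 0 (1::real))"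
    by (rule has_integral_bound[OF _ mexp_diff_has_integral[of A B, folded box_real(2)]])
      (simp_all add: norm_unitary_left norm_unitary_right unitary_mexp skew_scaleR assms)
  then show ?thesis by simp
qed

lemma continuous_on_mexp:
  assumes "\<And>A. A \<in> S \<Longrightarrow> skew A"
  shows "continuous_on S mexp"
  unfolding continuous_on_iff dist_norm
  using norm_mexp_diff_le assms by (meson le_less_trans)

text \<open>The derivative of the exponential at \<open>A\<close>, translated to the identity by left multiplication,
  is the average of the conjugations along \<open>u \<mapsto> mexp (u A)\<close>.\<close>

definition dexp :: "('n::finite) cmat \<Rightarrow> 'n cmat \<Rightarrow> 'n cmat" where
  "dexp A Z = integral {0..1} (\<lambda>u. mexp (- u *\<^sub>R A) ** Z ** mexp (u *\<^sub>R A))"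

lemma dexp_has_integral:
  "((\<lambda>u. mexp (- u *\<^sub>R A) ** Z ** mexp (u *\<^sub>R A)) has_integral dexp A Z) {0..1}"
  unfolding dexp_def
  by (intro integrable_integral integrable_continuous_interval continuous_intros mm.continuous_on)

lemma dexp_scaleR: "dexp A (r *\<^sub>R Z) = r *\<^sub>R dexp A Z"
  by (rule has_integral_unique[OF dexp_has_integral])
    (use has_integral_cmul[OF dexp_has_integral[of A Z], of r] in \<open>simp add: mm.scaleR_left mm.scaleR_right\<close>)

text \<open>Subtracting the linear term from Duhamel's integral leaves \<open>Z\<close> multiplied
  by \<open>mexp (u *\<^sub>R (A + Z)) - mexp (u *\<^sub>R A)\<close>, which the Lipschitz bound
  makes at most \<open>norm Z\<close>.\<close>

lemma mexp_add_approx: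
  assumes "skew A" "skew Z"
  shows "norm (mexp (A + Z) - mexp A - mexp A ** dexp A Z) \<le> (norm Z)\<^sup>2"
proof -
  have "((\<lambda>u. mexp ((1 - u) *\<^sub>R A) ** Z ** mexp (u *\<^sub>R (A + Z))
          - mexp A ** (mexp (- u *\<^sub>R A) ** Z ** mexp (u *\<^sub>R A)))
        has_integral (mexp (A + Z) - mexp A - mexp A ** dexp A Z)) {0..1}"
    using has_integral_diff[OF mexp_diff_has_integral[of A "A + Z"]
        has_integral_linear[OF dexp_has_integral[of A Z] mm.bounded_linear_right[of "mexp A"]]]
    by (simp add: o_def)
  moreover have "mexp A ** (mexp (- u *\<^sub>R A) ** Z ** mexp (u *\<^sub>R A)) = mexp ((1 - u) *\<^sub>R A) ** Z ** mexp (u *\<^sub>R A)" for u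
    using mexp_add_scaleR[of 1 A "- u"] by (simp add: matrix_mul_assoc)
  ultimately have "((\<lambda>u. mexp ((1 - u) *\<^sub>R A) ** (Z ** (mexp (u *\<^sub>R (A + Z)) - mexp (u *\<^sub>R A))))
        has_integral (mexp (A + Z) - mexp A - mexp A ** dexp A Z)) (cbox 0 1)"
    by (simp add: mm.diff_right matrix_mul_assoc)
  moreover have "norm (mexp ((1 - u) *\<^sub>R A) ** (Z ** (mexp (u *\<^sub>R (A + Z)) - mexp (u *\<^sub>R A)))) \<le> (norm Z)\<^sup>2"
    if "u \<in> cbox 0 1" for u
  proof -
    have "norm (mexp (u *\<^sub>R (A + Z)) - mexp (u *\<^sub>R A)) \<le> norm (u *\<^sub>R (A + Z) - u *\<^sub>R A)"
      by (intro norm_mexp_diff_le skew_scaleR skew_add assms)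
    also have "\<dots> = \<bar>u\<bar> * norm Z" by (simp add: algebra_simps)
    also have "\<dots> \<le> norm Z"
      using that by (intro mult_left_le_one_le) auto
    finally have "norm (Z ** (mexp (u *\<^sub>R (A + Z)) - mexp (u *\<^sub>R A))) \<le> norm Z * norm Z"
      by (intro order_trans[OF norm_matrix_mult_le] mult_left_mono) auto
    then show ?thesis
      by (simp add: norm_unitary_left unitary_mexp skew_scaleR assms power2_eq_square)
  qed
  ultimately have "norm (mexp (A + Z) - mexp A - mexp A ** dexp A Z) \<le> (norm Z)\<^sup>2 * measure lborel (cbox 0 (1::real))"
    by (intro has_integral_bound) auto
  then show ?thesis by simp
qed

lemma dexp_zero: "dexp 0 Z = Z"
  using has_integral_unique[OF dexp_has_integral[of 0 Z]] has_integral_const_real[of Z 0 1] by fastforce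

lemma mexp_approx_one: "skew Z \<Longrightarrow> norm (mexp Z - mat 1 - Z) \<le> (norm Z)\<^sup>2"
  using mexp_add_approx[of 0 Z] by (simp add: skew_def dexp_zero)

lemma mexp_line_has_vector_derivative:
  fixes A Z :: "('n::finite) cmat"
  assumes "skew A" "skew Z"
  shows "((\<lambda>s. mexp (A + s *\<^sub>R Z)) has_vector_derivative mexp A ** dexp A Z) (at 0)"
  unfolding has_vector_derivative_def has_derivative_at
proof (intro conjI)
  show "(\<lambda>h. norm (mexp (A + (0 + h) *\<^sub>R Z) - mexp (A + 0 *\<^sub>R Z) - h *\<^sub>R (mexp A ** dexp A Z)) / norm h) \<midarrow>0\<rightarrow> 0"
  proof (rule tendsto_sandwich[where f = "\<lambda>_. 0"])
    show "\<forall>\<^sub>F h in at 0. norm (mexp (A + (0 + h) *\<^sub>R Z) - mexp (A + 0 *\<^sub>R Z) - h *\<^sub>R (mexp A ** dexp A Z)) / norm h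
        \<le> \<bar>h\<bar> * (norm Z)\<^sup>2"
    proof (intro always_eventually allI)
      fix h :: real
      have "norm (mexp (A + h *\<^sub>R Z) - mexp A - h *\<^sub>R (mexp A ** dexp A Z)) \<le> (\<bar>h\<bar> * norm Z)\<^sup>2"
        using mexp_add_approx[OF assms(1) skew_scaleR[OF assms(2), of h]]
        by (simp add: dexp_scaleR mm.scaleR_right)
      then show "norm (mexp (A + (0 + h) *\<^sub>R Z) - mexp (A + 0 *\<^sub>R Z) - h *\<^sub>R (mexp A ** dexp A Z)) / norm h
        \<le> \<bar>h\<bar> * (norm Z)\<^sup>2"
        \<comment> \<open>At \<open>h = 0\<close> the quotient is \<open>0\<close> by the convention
          on division by zero.\<close>
        by (cases "h = 0") (simp_all add: divide_simps power2_eq_square mult_ac)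
    qed
    show "((\<lambda>h::real. \<bar>h\<bar> * (norm Z)\<^sup>2) \<longlongrightarrow> 0) (at 0)"
      by (auto intro!: tendsto_eq_intros)
  qed (simp_all add: always_eventually)
qed (rule bounded_linear_scaleR_left)

section \<open>Orthogonal projections and inner products with \<open>dexp\<close>\<close>

text \<open>The projection is the expansion in an orthonormal basis. Its bounded linearity lets it
  pass through integrals and derivatives.\<close>

lemma orthogonal_projection_exists:
  fixes S :: "'a::euclidean_space set"
  assumes S: "subspace S"
  obtains p where "bounded_linear p" "\<And>x. p x \<in> S" "\<And>x y. y \<in> S \<Longrightarrow> inner (x - p x) y = 0"
    "\<And>x. x \<in> S \<Longrightarrow> p x = x"
proof -
  obtain B where B: "B \<subseteq> S" "pairwise orthogonal B" "\<And>x. x \<in> B \<Longrightarrow> norm x = 1"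
      "independent B" "card B = dim S" "span B = S"
    by (rule orthonormal_basis_subspace[OF S]) blast
  have "finite B" using B(4) independent_imp_finite by blast
  define p where "p x = (\<Sum>b\<in>B. inner x b *\<^sub>R b)" for x
  have bl: "bounded_linear p"
    unfolding p_def
    by (intro bounded_linear_sum bounded_linear_compose[OF bounded_linear_scaleR_left] bounded_linear_inner_left)
  have pS: "p x \<in> S" for x
    unfolding p_def using S B(1) by (intro subspace_sum subspace_scale) auto
  have "inner (x - p x) b = 0" if "b \<in> B" for x b
  proof -
    have "inner (p x) b = (\<Sum>c\<in>B. if c = b then inner x b else 0)"
      unfolding p_def inner_sum_left
      using B(2,3) that by (intro sum.cong) (auto simp: pairwise_def orthogonal_def dot_square_norm)
    then show ?thesis using \<open>finite B\<close> that by (simp add: inner_diff_left)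
  qed
  then have orth: "inner (x - p x) y = 0" if "y \<in> S" for x y
    using that orthogonal_to_span[of y B "x - p x"] B(6) by (simp add: orthogonal_def)
  have idem: "p x = x" if "x \<in> S" for x
    using orth[OF subspace_diff[OF S that pS[of x]], of x] by simp
  show ?thesis by (rule that[OF bl pS orth idem])
qed

text \<open>The projection onto \<open>S\<close> commutes with the integral and fixes every value of
  the integrand, hence fixes the integral.\<close>

lemma has_integral_subspace:
  fixes f :: "'a::euclidean_space \<Rightarrow> 'b::euclidean_space"
  assumes S: "subspace S" and f: "(f has_integral y) D" and "\<And>x. x \<in> D \<Longrightarrow> f x \<in> S"
  shows "y \<in> S"
proof -
  obtain p where p: "bounded_linear p" "\<And>x. p x \<in> S" "\<And>x. x \<in> S \<Longrightarrow> p x = x"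
    using orthogonal_projection_exists[OF S] by metis
  have "((p \<circ> f) has_integral p y) D" by (rule has_integral_linear[OF f p(1)])
  then have "(f has_integral p y) D"
    by (rule has_integral_eq[rotated]) (simp add: p(3) assms(3))
  then have "p y = y" using f by (rule has_integral_unique)
  then show ?thesis using p(2) by metis
qed

lemma adj_mexp_skew: "skew A \<Longrightarrow> adj (mexp A) = mexp (- A)"
  by (simp add: adj_mexp skew_def)

lemma inner_conj: "inner X (adj V ** Z ** V) = inner (V ** X ** adj V) Z"
  for V X Z :: "('n::finite) cmat"
  unfolding inner_matrix_mult_right[of "V ** X"] inner_matrix_mult_left[of V X]
  by (simp add: matrix_mul_assoc)

text \<open>Moving each averaged conjugation across the inner product lets it act on
  \<open>X\<close>, which it fixes because \<open>X\<close> commutes with \<open>A\<close>; the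
  integrand is therefore constant.\<close>

lemma inner_dexp_commuting:
  assumes A: "skew A" and com: "X ** A = A ** X"
  shows "inner X (dexp A Z) = inner X Z"
proof -
  have "inner X (mexp (- u *\<^sub>R A) ** Z ** mexp (u *\<^sub>R A)) = inner X Z" for u
  proof -
    have "inner X (mexp (- u *\<^sub>R A) ** Z ** mexp (u *\<^sub>R A))
        = inner (mexp (u *\<^sub>R A) ** X ** mexp (- u *\<^sub>R A)) Z"
      using inner_conj[of X "mexp (u *\<^sub>R A)" Z] by (simp add: adj_mexp_skew skew_scaleR A)
    also have "mexp (u *\<^sub>R A) ** X = X ** mexp (u *\<^sub>R A)"
      by (rule mexp_commute[symmetric]) (simp add: mm.scaleR_left mm.scaleR_right com)
    finally show ?thesis
      using mexp_minus_mult[of "u *\<^sub>R A"] by (simp flip: matrix_mul_assoc)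
  qed
  then have "((\<lambda>u. inner X Z) has_integral inner X (dexp A Z)) {0..1::real}"
    using has_integral_linear[OF dexp_has_integral[of A Z] bounded_linear_inner_right[of X]] by (simp add: o_def)
  then show ?thesis
    using has_integral_unique[OF _ has_integral_const_real[of "inner X Z" 0 1]] by simp
qed

text \<open>Each conjugation moves \<open>D\<close> by at most \<open>2 * norm A * norm D\<close>,
  less than \<open>norm D\<close>, so the average keeps a positive component along
  \<open>D\<close>.\<close>

lemma inner_dexp_pos:
  assumes A: "skew A" "norm A < 1 / 2" and D: "D \<noteq> 0"
  shows "inner D (dexp A D) > 0"
proof -
  have "((\<lambda>u. mexp (- u *\<^sub>R A) ** D ** mexp (u *\<^sub>R A) - D) has_integral dexp A D - D) (cbox 0 1)"
    using has_integral_diff[OF dexp_has_integral has_integral_const_real[of D 0 1]] by simp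
  moreover have "norm (mexp (- u *\<^sub>R A) ** D ** mexp (u *\<^sub>R A) - D) \<le> 2 * norm A * norm D"
    if "u \<in> cbox 0 1" for u
  proof -
    have near_one: "norm (mexp (v *\<^sub>R A) - mat 1) \<le> norm A" if "\<bar>v\<bar> \<le> 1" for v
    proof -
      have "norm (mexp (v *\<^sub>R A) - mexp (0 *\<^sub>R A)) \<le> norm (v *\<^sub>R A - 0 *\<^sub>R A)"
        by (intro norm_mexp_diff_le skew_scaleR A)
      also have "\<dots> \<le> norm A" using that by (simp add: mult_left_le_one_le)
      finally show ?thesis by simp
    qed
    \<comment> \<open>The two conjugating factors are replaced by the identity one at a time, each
      at a cost of at most \<open>norm A * norm D\<close>.\<close>
    have "mexp (- u *\<^sub>R A) ** D ** mexp (u *\<^sub>R A) - D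
        = (mexp (- u *\<^sub>R A) - mat 1) ** D ** mexp (u *\<^sub>R A) + D ** (mexp (u *\<^sub>R A) - mat 1)"
      by (simp add: mm.diff_left mm.diff_right)
    also have "norm \<dots> \<le> norm ((mexp (- u *\<^sub>R A) - mat 1) ** D ** mexp (u *\<^sub>R A)) + norm (D ** (mexp (u *\<^sub>R A) - mat 1))"
      by (rule norm_triangle_ineq)
    also have "\<dots> = norm ((mexp (- u *\<^sub>R A) - mat 1) ** D) + norm (D ** (mexp (u *\<^sub>R A) - mat 1))"
      by (simp add: norm_unitary_right unitary_mexp skew_scaleR A)
    also have "\<dots> \<le> norm A * norm D + norm D * norm A"
      using that
      by (intro add_mono order_trans[OF norm_matrix_mult_le] mult_mono near_one) auto
    finally show ?thesis by simp
  qed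
  ultimately have "norm (dexp A D - D) \<le> 2 * norm A * norm D * measure lborel (cbox 0 (1::real))"
    by (intro has_integral_bound) auto
  then have "norm (dexp A D - D) \<le> 2 * norm A * norm D" by simp
  then have "norm D * norm (dexp A D - D) \<le> norm D * (2 * norm A * norm D)"
    by (rule mult_left_mono) simp
  moreover have "\<bar>inner D (dexp A D - D)\<bar> \<le> norm D * norm (dexp A D - D)"
    by (rule Cauchy_Schwarz_ineq2)
  moreover have "2 * norm A * (norm D * norm D) < 1 * (norm D * norm D)"
    using A D by (intro mult_strict_right_mono) auto
  moreover have "inner D D = norm D * norm D"
    by (simp add: dot_square_norm power2_eq_square)
  ultimately show ?thesis by (simp add: inner_diff_right algebra_simps)
qed

section \<open>Ordered products of exponentials\<close>

text \<open>Later factors stand on the left, as for propagators over successive time steps. Weights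
  are kept apart from exponents so that equal exponents merge by adding weights.\<close>

fun texp :: "(nat \<Rightarrow> real) \<Rightarrow> (nat \<Rightarrow> ('n::finite) cmat) \<Rightarrow> nat \<Rightarrow> 'n cmat" where
  "texp w X 0 = mat 1"
| "texp w X (Suc i) = mexp (w i *\<^sub>R X i) ** texp w X i"

lemma texp_cong: "(\<And>j. j < i \<Longrightarrow> X j = Y j) \<Longrightarrow> texp w X i = texp w Y i"
  by (induction i) auto

text \<open>Isolates the dependence on one exponent: \<open>R\<close> collects the factors after
  position \<open>i\<close> and is the same for every \<open>Y\<close>.\<close>

lemma texp_update:
  assumes "i < n"
  obtains R where "\<And>Y. texp w (X(i := Y)) n = R ** mexp (w i *\<^sub>R Y) ** texp w X i"
proof -
  have "\<exists>R. \<forall>Y. texp w (X(i := Y)) n = R ** mexp (w i *\<^sub>R Y) ** texp w X i"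
    using assms
  proof (induction n)
    case (Suc n)
    show ?case
    proof (cases "i = n")
      case True
      then have "texp w (X(i := Y)) n = texp w X i" for Y
        using texp_cong[of n "X(i := Y)" X w] by auto
      then show ?thesis using True by (intro exI[of _ "mat 1"]) (simp del: fun_upd_apply add: fun_upd_same)
    next
      case False
      then have "i < n" using Suc.prems by simp
      then obtain R where "\<forall>Y. texp w (X(i := Y)) n = R ** mexp (w i *\<^sub>R Y) ** texp w X i"
        using Suc.IH by blast
      then show ?thesis
        using False by (intro exI[of _ "mexp (w n *\<^sub>R X n) ** R"])
          (simp add: matrix_mul_assoc del: fun_upd_apply add: fun_upd_other)
    qed
  qed simp
  then show ?thesis using that by blast
qed

lemma unitary_texp: "(\<And>j. j < n \<Longrightarrow> skew (X j)) \<Longrightarrow> unitary (texp w X n)"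
  by (induction n) (simp add: unitary_def, simp add: unitary_mult unitary_mexp skew_scaleR)

text \<open>Sequences carry the product topology, in which the competitors of the later minimisation
  form a compact set.\<close>

lemma continuous_on_texp:
  fixes w :: "nat \<Rightarrow> real" and S :: "(nat \<Rightarrow> ('n::finite) cmat) set"
  assumes "\<And>X j. X \<in> S \<Longrightarrow> skew (X j)"
  shows "continuous_on S (\<lambda>X. texp w X n)"
proof (induction n)
  case (Suc n)
  have "continuous_on S (\<lambda>X. w n *\<^sub>R X n)"
    by (intro continuous_intros continuous_on_subset[OF continuous_on_product_coordinates]) auto
  then have "continuous_on S (\<lambda>X. mexp (w n *\<^sub>R X n))"
    using continuous_on_compose2[OF continuous_on_mexp[of "Collect skew"], of S "\<lambda>X. w n *\<^sub>R X n"]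
      assms skew_scaleR by auto
  then show ?case using Suc by (simp add: mm.continuous_on)
qed simp

section \<open>Lie algebras of skew-Hermitian matrices\<close>

locale skew_lie_algebra =
  fixes L :: "('n::finite) cmat set"
  assumes subspace: "subspace L"
    and skew_mem: "X \<in> L \<Longrightarrow> skew X"
    and commutator_mem: "X \<in> L \<Longrightarrow> Y \<in> L \<Longrightarrow> commutator X Y \<in> L"
begin

lemma scaleR_mem: "X \<in> L \<Longrightarrow> r *\<^sub>R X \<in> L"
  using subspace by (rule subspace_scale)

text \<open>Conjugation by \<open>mexp (u A)\<close> moves \<open>Z\<close> along a solution of a linear equation whose generator is
  skew and preserves \<open>L\<close>, hence also its orthogonal complement; so the component orthogonal to \<open>L\<close>
  has constant norm.\<close>

lemma conj_mem:
  assumes A: "A \<in> L" and Z: "Z \<in> L"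
  shows "mexp (- A) ** Z ** mexp A \<in> L"
proof -
  obtain p where p: "bounded_linear p" "\<And>x. p x \<in> L" "\<And>x y. y \<in> L \<Longrightarrow> inner (x - p x) y = 0"
      "\<And>x. x \<in> L \<Longrightarrow> p x = x"
    using orthogonal_projection_exists[OF subspace] by blast
  define F where "F u = mexp (- u *\<^sub>R A) ** Z ** mexp (u *\<^sub>R A)" for u :: real
  define N where "N u = F u - p (F u)" for u
  have com: "A ** mexp (s *\<^sub>R A) = mexp (s *\<^sub>R A) ** A" for s :: real
    by (rule mexp_commute) (simp add: mm.scaleR_left mm.scaleR_right)
  have F': "(F has_vector_derivative commutator (F u) A) (at u within UNIV)" for u
    unfolding F_def
    by (rule has_vector_derivative_eq_rhs, rule mm.has_vector_derivative, rule mm.has_vector_derivative,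
        (rule mexp_scaleR_chain_has_vector_derivative derivative_eq_intros refl)+)
      (simp add: com mm.minus_left mm.zero_right commutator_def matrix_mul_assoc)
  then have N': "(N has_vector_derivative commutator (F u) A - p (commutator (F u) A)) (at u within UNIV)" for u
    unfolding N_def
    by (intro has_vector_derivative_diff bounded_linear.has_vector_derivative[OF p(1)])
  have adjA: "adj A = - A" using skew_mem[OF A] by (simp add: skew_def)
  \<comment> \<open>The commutator of \<open>p (F u)\<close> with \<open>A\<close> lies in
    \<open>L\<close>, hence is orthogonal to \<open>N u\<close>; and multiplication by the skew
    \<open>A\<close> on either side is a skew map, so it sends \<open>N u\<close> to something
    orthogonal to it.\<close>
  have orth: "inner (N u) (commutator (F u) A) = 0" for u
  proof -
    have "inner (N u) (commutator (p (F u)) A) = 0"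
      unfolding N_def using p A commutator_mem by blast
    moreover have "inner (N u) (A ** N u) = 0" "inner (N u) (N u ** A) = 0"
      using inner_matrix_mult_left[of A "N u" "N u"] inner_matrix_mult_right[of "N u" A "N u"]
      
      unfolding adjA mm.minus_left mm.minus_right inner_minus_right
        inner_commute[of "A ** N u"] inner_commute[of "N u ** A"] by linarith+
    moreover have "commutator (F u) A = commutator (p (F u)) A + (N u ** A - A ** N u)"
      by (simp add: N_def commutator_def mm.diff_left mm.diff_right)
    ultimately show ?thesis by (simp add: inner_add_right inner_diff_right)
  qed
  have "((\<lambda>u. inner (N u) (N u)) has_vector_derivative 0) (at u within UNIV)" for u
  proof (rule has_vector_derivative_eq_rhs[OF bounded_bilinear.has_vector_derivative[OF bounded_bilinear_inner N' N']])
    have "inner (N u) (p (commutator (F u) A)) = 0"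
      unfolding N_def by (rule p(3)[OF p(2)])
    with orth[of u] have "inner (N u) (commutator (F u) A - p (commutator (F u) A)) = 0"
      unfolding inner_diff_right by linarith
    then show "inner (N u) (commutator (F u) A - p (commutator (F u) A))
        + inner (commutator (F u) A - p (commutator (F u) A)) (N u) = 0"
      unfolding inner_commute[of _ "N u"] by linarith
  qed
  then obtain c where "\<And>u. inner (N u) (N u) = c"
    using has_vector_derivative_zero_constant[of UNIV "\<lambda>u. inner (N u) (N u)"] by auto
  then have "inner (N 1) (N 1) = inner (N 0) (N 0)" by metis
  also have "N 0 = 0" using p(4)[OF Z] by (simp add: N_def F_def)
  finally have "F 1 = p (F 1)" by (simp add: N_def)
  then show ?thesis using p(2)[of "F 1"] by (simp add: F_def)
qed

lemma dexp_mem: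
  assumes A: "A \<in> L" and Z: "Z \<in> L"
  shows "dexp A Z \<in> L"
proof (rule has_integral_subspace[OF subspace dexp_has_integral])
  show "mexp (- u *\<^sub>R A) ** Z ** mexp (u *\<^sub>R A) \<in> L" for u
    using conj_mem[OF scaleR_mem[OF A, of u] Z] by simp
qed

section \<open>Minimisers of the penalised energy\<close>

text \<open>At a minimiser of this energy the exponents \<open>X i\<close> all coincide. The exact constraint
  \<open>texp w X n = g\<close> is relaxed to a penalty because perturbing an exponent inside \<open>L\<close> while keeping
  the product fixed would require a logarithm with values in \<open>L\<close>.\<close>

definition energy :: "(nat \<Rightarrow> real) \<Rightarrow> real \<Rightarrow> 'n cmat \<Rightarrow> nat \<Rightarrow> (nat \<Rightarrow> 'n cmat) \<Rightarrow> real" where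
  "energy w K g n X = (\<Sum>i<n. w i * (norm (X i))\<^sup>2) + K * (norm (texp w X n - g))\<^sup>2"

text \<open>The energy along the line \<open>X i + s *\<^sub>R Z\<close>, which stays in
  \<open>L\<close>, is minimal at \<open>s = 0\<close>; the left-hand side is half of its derivative
  there.\<close>

lemma first_variation:
  assumes i: "i < n" and X: "\<And>j. X j \<in> L" and Z: "Z \<in> L"
    and min: "\<And>Y. Y \<in> L \<Longrightarrow> energy w K g n X \<le> energy w K g n (X(i := Y))"
  defines "P \<equiv> texp w X n" and "V \<equiv> texp w X i"
  shows "w i * inner (X i) Z
    + K * inner (P - g) (P ** (adj V ** dexp (w i *\<^sub>R X i) (w i *\<^sub>R Z) ** V)) = 0"
proof -
  obtain R where R: "\<And>Y. texp w (X(i := Y)) n = R ** mexp (w i *\<^sub>R Y) ** V"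
    using texp_update[OF i] unfolding V_def by blast
  define A where "A = w i *\<^sub>R X i"
  have skewX: "skew A" "skew (w i *\<^sub>R Z)"
    unfolding A_def by (intro skew_scaleR skew_mem X Z)+
  have P: "P = R ** mexp A ** V"
    using R[of "X i"] unfolding P_def A_def fun_upd_triv .
  have "unitary V"
    unfolding V_def by (rule unitary_texp) (simp add: skew_mem X)
  then have V: "V ** adj V = mat 1" by (rule unitary_right)
  define c where "c = (\<Sum>j\<in>{..<n} - {i}. w j * (norm (X j))\<^sup>2)"
  define q where "q s = X i + s *\<^sub>R Z" for s :: real
  define G where "G s = R ** mexp (A + s *\<^sub>R (w i *\<^sub>R Z)) ** V - g" for s :: real
  define G' where "G' = P ** (adj V ** dexp A (w i *\<^sub>R Z) ** V)"
  define f where "f s = c + w i * inner (q s) (q s) + K * inner (G s) (G s)" for s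
  have f: "f s = energy w K g n (X(i := q s))" for s
  proof -
    have "(\<Sum>j<n. w j * (norm ((X(i := q s)) j))\<^sup>2) = w i * (norm (q s))\<^sup>2 + c"
      using i unfolding c_def by (subst sum.remove[of _ i]) auto
    moreover have "w i *\<^sub>R q s = A + s *\<^sub>R (w i *\<^sub>R Z)"
      by (simp add: q_def A_def scaleR_add_right mult.commute)
    ultimately show ?thesis
      unfolding energy_def f_def R G_def power2_norm_eq_inner by simp
  qed
  have q': "(q has_vector_derivative Z) (at 0)"
    unfolding q_def by (auto intro!: derivative_eq_intros)
  have "(G has_vector_derivative R ** (mexp A ** dexp A (w i *\<^sub>R Z)) ** V) (at 0)"
    unfolding G_def
    by (intro has_vector_derivative_diff_const[THEN iffD2]
        bounded_linear.has_vector_derivative[OF mm.bounded_linear_left]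
        bounded_linear.has_vector_derivative[OF mm.bounded_linear_right]
        mexp_line_has_vector_derivative skewX)
  \<comment> \<open>Inserting \<open>V ** adj V\<close> turns the variation into a left translate by
    the whole product \<open>P\<close>, which eliminates \<open>R\<close>.\<close>
  also have "R ** (mexp A ** dexp A (w i *\<^sub>R Z)) ** V
      = R ** mexp A ** (V ** adj V) ** dexp A (w i *\<^sub>R Z) ** V"
    by (simp add: V matrix_mul_assoc)
  also have "\<dots> = G'"
    by (simp add: G'_def P matrix_mul_assoc)
  finally have G': "(G has_vector_derivative G') (at 0)" .
  have "(f has_vector_derivative (0 + w i * (inner (q 0) Z + inner Z (q 0))
      + K * (inner (G 0) G' + inner G' (G 0)))) (at 0)"
    unfolding f_def
    by (intro has_vector_derivative_add has_vector_derivative_const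
        bounded_linear.has_vector_derivative[OF bounded_linear_mult_right]
        bounded_bilinear.has_vector_derivative[OF bounded_bilinear_inner] q' G')
  then have "(f has_real_derivative (w i * (inner (q 0) Z + inner Z (q 0))
      + K * (inner (G 0) G' + inner G' (G 0)))) (at 0)"
    by (simp add: has_real_derivative_iff_has_vector_derivative)
  moreover have "f 0 \<le> f s" for s
  proof -
    have "f 0 = energy w K g n X" unfolding f by (simp add: q_def)
    also have "\<dots> \<le> f s"
      unfolding f by (intro min) (simp add: q_def subspace_add[OF subspace] X scaleR_mem Z)
    finally show ?thesis .
  qed
  ultimately have "w i * (inner (q 0) Z + inner Z (q 0)) + K * (inner (G 0) G' + inner G' (G 0)) = 0"
    using DERIV_local_min[of f _ 0 1] by auto
  moreover have "q 0 = X i" "G 0 = P - g"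
    by (simp_all add: q_def G_def P)
  ultimately have "2 * (w i * inner (X i) Z + K * inner (P - g) G') = 0"
    unfolding inner_commute[of Z] inner_commute[of G'] by (simp add: algebra_simps)
  then show ?thesis unfolding G'_def A_def by simp
qed

text \<open>Induction along the product. If all earlier exponents equal \<open>Q\<close>, then
  \<open>V\<close> commutes with \<open>Q\<close> and conjugation by it drops out of the first
  variation; what remains says that \<open>X i - Q\<close> is orthogonal to the image of
  \<open>L\<close> under \<open>dexp A\<close>.\<close>

lemma critical_point_constant:
  assumes w: "\<And>i. i < n \<Longrightarrow> w i > 0" and X: "\<And>i. X i \<in> L"
    and small: "\<And>i. i < n \<Longrightarrow> w i * norm (X i) < 1 / 2"
    and min: "\<And>i Y. i < n \<Longrightarrow> Y \<in> L \<Longrightarrow> energy w K g n X \<le> energy w K g n (X(i := Y))"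
  obtains Q where "Q \<in> L" "\<And>i. i < n \<Longrightarrow> X i = Q" "texp w X n = mexp ((\<Sum>i<n. w i) *\<^sub>R Q)"
proof -
  obtain p where p: "bounded_linear p" "\<And>x. p x \<in> L" "\<And>x y. y \<in> L \<Longrightarrow> inner (x - p x) y = 0"
    using orthogonal_projection_exists[OF subspace] by metis
  define P where "P = texp w X n"
  \<comment> \<open>Minus half the gradient of the penalty at \<open>P\<close>, translated to the
    identity and projected onto \<open>L\<close>; it does not depend on the index.\<close>
  define Q where "Q = - K *\<^sub>R p (adj P ** (P - g))"
  have Q: "Q \<in> L" unfolding Q_def by (rule scaleR_mem[OF p(2)])
  have "(\<forall>j<i. X j = Q) \<and> texp w X i = mexp ((\<Sum>j<i. w j) *\<^sub>R Q)" if "i \<le> n" for i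
    using that
  proof (induction i)
    case (Suc i)
    then have i: "i < n" by simp
    define \<sigma> where "\<sigma> = (\<Sum>j<i. w j)"
    define V where "V = mexp (\<sigma> *\<^sub>R Q)"
    define A where "A = w i *\<^sub>R X i"
    have V: "texp w X i = V" using Suc unfolding V_def \<sigma>_def by simp
    have A: "A \<in> L" unfolding A_def by (rule scaleR_mem[OF X])
    have adjV: "adj V = mexp (- (\<sigma> *\<^sub>R Q))"
      unfolding V_def by (rule adj_mexp_skew[OF skew_mem[OF scaleR_mem[OF Q]]])
    have VQ: "V ** Q ** adj V = Q"
    proof -
      have "V ** Q = Q ** V" unfolding V_def
        by (rule mexp_commute[symmetric]) (simp add: mm.scaleR_left mm.scaleR_right)
      then show ?thesis
        unfolding adjV using mexp_minus_mult[of "\<sigma> *\<^sub>R Q"]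
        by (simp add: V_def flip: matrix_mul_assoc)
    qed
    have D: "inner (X i - Q) (dexp A Z) = 0" if Z: "Z \<in> L" for Z
    proof -
      define Y where "Y = dexp A Z"
      have Y: "adj V ** Y ** V \<in> L"
        unfolding adjV unfolding V_def Y_def by (intro conj_mem dexp_mem scaleR_mem Q A Z)
      have "inner (P - g) (P ** (adj V ** dexp A (w i *\<^sub>R Z) ** V))
          = w i * inner (adj P ** (P - g)) (adj V ** Y ** V)"
        unfolding dexp_scaleR mm.scaleR_left mm.scaleR_right inner_scaleR_right Y_def
        by (subst inner_commute, subst inner_matrix_mult_left, subst inner_commute) (rule refl)
      also have "inner (adj P ** (P - g)) (adj V ** Y ** V) = inner (p (adj P ** (P - g))) (adj V ** Y ** V)"
        using p(3)[OF Y, of "adj P ** (P - g)"] by (simp add: inner_diff_left)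
      finally have "K * inner (P - g) (P ** (adj V ** dexp A (w i *\<^sub>R Z) ** V)) = - w i * inner Q (adj V ** Y ** V)"
        by (simp add: Q_def)
      also have "inner Q (adj V ** Y ** V) = inner Q Y"
        unfolding inner_conj VQ ..
      finally have "w i * inner (X i) Z - w i * inner Q Y = 0"
        using first_variation[OF i X Z min[OF i]] unfolding V P_def[symmetric] A_def[symmetric] by simp
      then have "inner (X i) Z = inner Q Y" using w[OF i] by simp
      \<comment> \<open>\<open>X i\<close> commutes with its multiple \<open>A\<close>, so
        \<open>dexp A\<close> can be inserted here too, and both terms pair with the same
        matrix.\<close>
      moreover have "inner (X i) Y = inner (X i) Z"
        unfolding Y_def
        by (rule inner_dexp_commuting[OF skew_mem[OF A]]) (simp add: A_def mm.scaleR_left mm.scaleR_right)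
      ultimately show ?thesis unfolding Y_def by (simp add: inner_diff_left)
    qed
    \<comment> \<open>Otherwise \<open>Z = X i - Q\<close> contradicts the positivity of
      \<open>dexp A\<close> for small \<open>A\<close>.\<close>
    have "X i = Q"
    proof (rule ccontr)
      assume "X i \<noteq> Q"
      moreover have "norm A < 1 / 2" unfolding A_def using small[OF i] w[OF i] by simp
      ultimately have "inner (X i - Q) (dexp A (X i - Q)) > 0"
        using inner_dexp_pos[OF skew_mem[OF A]] by simp
      with D[OF subspace_diff[OF subspace X Q], of i] show False by simp
    qed
    then show ?case
      using Suc V mexp_add_scaleR[of "w i" Q \<sigma>]
      by (auto simp: V_def \<sigma>_def less_Suc_eq add.commute)
  qed simp
  from this[of n] Q that show ?thesis by blast
qed

text \<open>The minimiser is found on a compact product of balls and shown to be optimal in each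
  coordinate over all of \<open>L\<close>, as the first variation requires.\<close>

lemma word_shortening:
  assumes w: "\<And>i. i < n \<Longrightarrow> w i > 0" and X: "\<And>i. i < n \<Longrightarrow> X i \<in> L" "\<And>i. i < n \<Longrightarrow> norm (X i) \<le> 1"
    and small: "\<And>i. i < n \<Longrightarrow> w i * (\<Sum>i<n. w i) < 1 / 4" and K: "K > 0"
  obtains C where "C \<in> L" "norm C \<le> (\<Sum>i<n. w i)"
    "K * (norm (mexp C - texp w X n))\<^sup>2 \<le> (\<Sum>i<n. w i)"
proof -
  define W where "W = (\<Sum>i<n. w i)"
  define g where "g = texp w X n"
  define J where "J = energy w K g n"
  \<comment> \<open>An \<open>i\<close>-th exponent of norm at least \<open>r i\<close> alone costs
    more than \<open>W\<close>, which bounds the minimal energy; the added \<open>1\<close> makes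
    this strict and admits the given \<open>X i\<close>.\<close>
  define r where "r i = sqrt (W / w i) + 1" for i
  \<comment> \<open>Coordinates from \<open>n\<close> on are pinned to \<open>0\<close>, so that the
    product over all indices is compact.\<close>
  define B where "B i = (if i < n then L \<inter> cball 0 (r i) else {0})" for i
  define S where "S = (\<Pi>\<^sub>E i\<in>UNIV. B i)"
  define X0 where "X0 i = (if i < n then X i else 0)" for i
  have W0: "W \<ge> 0" unfolding W_def by (intro sum_nonneg) (use w in force)
  have r1: "r i \<ge> 1" if "i < n" for i
    using W0 w[OF that] by (simp add: r_def)
  have r2: "w i * (r i)\<^sup>2 > W" if "i < n" for i
  proof -
    have "W / w i = (sqrt (W / w i))\<^sup>2" using W0 w[OF that] by simp
    also have "\<dots> < (r i)\<^sup>2" unfolding r_def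
      using W0 w[OF that] by (intro power_strict_mono) auto
    finally show ?thesis using w[OF that] by (simp add: field_simps)
  qed
  have zero: "0 \<in> L" using subspace by (rule subspace_0)
  have memS: "Y \<in> S \<longleftrightarrow> (\<forall>i. Y i \<in> B i)" for Y by (auto simp: S_def PiE_def)
  have BL: "B i \<subseteq> L" for i by (auto simp: B_def zero)
  have "compact (B i)" for i
    unfolding B_def using closed_subspace[OF subspace] by (simp add: closed_Int_compact)
  then have "compact S"
    unfolding S_def
    using compactin_PiE[of "\<lambda>_. euclidean" UNIV B] unfolding euclidean_product_topology by simp
  moreover have X0S: "X0 \<in> S"
    unfolding memS by (auto simp: X0_def B_def X intro: order_trans[OF X(2) r1])
  moreover have "continuous_on S J"
  proof -
    have "continuous_on S (\<lambda>X. texp w X n)"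
      by (rule continuous_on_texp) (use memS BL skew_mem in blast)
    then show ?thesis
      unfolding J_def energy_def
      by (intro continuous_intros continuous_on_subset[OF continuous_on_product_coordinates]) auto
  qed
  ultimately obtain Y where Y: "Y \<in> S" and minS: "\<And>Z. Z \<in> S \<Longrightarrow> J Y \<le> J Z"
    using continuous_attains_inf[of S J] by blast
  have "texp w X0 n = g" unfolding g_def by (rule texp_cong) (simp add: X0_def)
  then have "J X0 = (\<Sum>i<n. w i * (norm (X i))\<^sup>2)"
    unfolding J_def energy_def by (simp add: X0_def)
  also have "\<dots> \<le> W"
    unfolding W_def by (intro sum_mono) (use w X(2) in \<open>simp add: abs_square_le_1 less_imp_le mult_left_le\<close>)
  finally have JY: "J Y \<le> W" using minS[OF X0S] by simp
  have term_le: "w i * (norm (Z i))\<^sup>2 \<le> J Z" if "i < n" for i Z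
  proof -
    have "w i * (norm (Z i))\<^sup>2 \<le> (\<Sum>i<n. w i * (norm (Z i))\<^sup>2)"
      using that w by (intro member_le_sum) (auto simp: less_imp_le)
    then show ?thesis unfolding J_def energy_def using K by (simp add: add_increasing2)
  qed
  have YL: "Y i \<in> L" for i using Y BL memS by blast
  have min: "J Y \<le> J (Y(i := Z))" if i: "i < n" and Z: "Z \<in> L" for i Z
  proof (cases "norm Z \<le> r i")
    case True
    then have "Z \<in> B i" using i Z by (simp add: B_def)
    then have "Y(i := Z) \<in> S" using Y unfolding memS by simp
    then show ?thesis by (rule minS)
  next
    case False
    then have "w i * (r i)\<^sup>2 \<le> w i * (norm Z)\<^sup>2"
      using w[OF i] r1[OF i] by (intro mult_left_mono power_mono) auto
    with r2[OF i] JY term_le[OF i, of "Y(i := Z)"] show ?thesis by simp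
  qed
  \<comment> \<open>The square of \<open>w i * norm (Y i)\<close> is \<open>w i\<close> times one
    term of the energy, hence at most \<open>w i * W\<close>; this is where the bound
    \<open>1 / 4\<close> enters.\<close>
  have smallY: "w i * norm (Y i) < 1 / 2" if i: "i < n" for i
  proof -
    have "(w i * norm (Y i))\<^sup>2 = w i * (w i * (norm (Y i))\<^sup>2)"
      by (simp add: power2_eq_square)
    also have "\<dots> \<le> w i * W"
      using term_le[OF i, of Y] JY w[OF i] by (intro mult_left_mono) auto
    also have "\<dots> < (1 / 2)\<^sup>2" using small[OF i] by (simp add: W_def power2_eq_square)
    finally show ?thesis by (rule power2_less_imp_less) simp
  qed
  obtain Q where Q: "Q \<in> L" "\<And>i. i < n \<Longrightarrow> Y i = Q" "texp w Y n = mexp (W *\<^sub>R Q)"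
    using critical_point_constant[OF w YL smallY min[unfolded J_def]] unfolding W_def by blast
  have "J Y = W * (norm Q)\<^sup>2 + K * (norm (mexp (W *\<^sub>R Q) - g))\<^sup>2"
    unfolding J_def energy_def Q(3) by (simp add: Q(2) W_def sum_distrib_right)
  then have JQ: "W * (norm Q)\<^sup>2 + K * (norm (mexp (W *\<^sub>R Q) - g))\<^sup>2 \<le> W" using JY by simp
  moreover have "K * (norm (mexp (W *\<^sub>R Q) - g))\<^sup>2 \<ge> 0" "W * (norm Q)\<^sup>2 \<ge> 0" using K W0 by auto
  ultimately have le: "W * (norm Q)\<^sup>2 \<le> W" "K * (norm (mexp (W *\<^sub>R Q) - g))\<^sup>2 \<le> W" by linarith+
  \<comment> \<open>Multiplying the energy bound by \<open>W\<close>, instead of dividing by it,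
    also covers \<open>W = 0\<close>.\<close>
  have "(norm (W *\<^sub>R Q))\<^sup>2 = W * (W * (norm Q)\<^sup>2)"
    by (simp add: power2_eq_square)
  also have "\<dots> \<le> W\<^sup>2" unfolding power2_eq_square[of W] using le(1) W0 by (rule mult_left_mono)
  finally have "norm (W *\<^sub>R Q) \<le> W" using W0 by (rule power2_le_imp_le)
  with le(2) show ?thesis
    using that[of "W *\<^sub>R Q"] scaleR_mem[OF Q(1)] unfolding W_def g_def by blast
qed

section \<open>Approximating a propagator by one exponential\<close>

text \<open>Here \<open>a\<close> stands for \<open>-i\<close> times the Hamiltonian. The evolution
  equation is in integral form, which makes sense where \<open>a\<close> jumps.\<close>

context
  fixes a U :: "real \<Rightarrow> 'n cmat" and T B :: real
  assumes T: "T \<ge> 0"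
    and a_mem: "\<And>t. t \<in> {0..T} \<Longrightarrow> a t \<in> L"
    and a_le: "\<And>t. t \<in> {0..T} \<Longrightarrow> norm (a t) \<le> B"
    and a_int: "a integrable_on {0..T}"
    and norm_a_int: "(\<lambda>t. norm (a t)) integrable_on {0..T}"
    and U_int: "\<And>t. t \<in> {0..T} \<Longrightarrow> ((\<lambda>s. a s ** U s) has_integral (U t - mat 1)) {0..t}"
    and U_unitary: "\<And>t. t \<in> {0..T} \<Longrightarrow> unitary (U t)"
begin

lemma B_nonneg: "B \<ge> 0"
  using order_trans[OF norm_ge_zero a_le[of 0]] T by simp

lemma propagator_diff:
  assumes "0 \<le> s" "s \<le> t" "t \<le> T"
  shows "((\<lambda>u. a u ** U u) has_integral (U t - U s)) {s..t}"
proof -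
  have int: "(\<lambda>u. a u ** U u) integrable_on {0..t}"
    using U_int[of t] assms by (auto simp: integrable_on_def)
  have "integral {0..s} (\<lambda>u. a u ** U u) + integral {s..t} (\<lambda>u. a u ** U u) = integral {0..t} (\<lambda>u. a u ** U u)"
    by (rule Henstock_Kurzweil_Integration.integral_combine[OF assms(1,2) int])
  then have "integral {s..t} (\<lambda>u. a u ** U u) = U t - U s"
    using U_int[of t, THEN integral_unique] U_int[of s, THEN integral_unique] assms
    by (auto simp: eq_diff_eq' eq_diff_eq add.commute)
  moreover have "(\<lambda>u. a u ** U u) integrable_on {s..t}"
    by (rule integrable_on_subinterval[OF int]) (use assms in auto)
  ultimately show ?thesis by (metis integrable_integral)
qed

lemma norm_propagator_diff_le:
  assumes "0 \<le> s" "s \<le> t" "t \<le> T"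
  shows "norm (U t - U s) \<le> B * (t - s)"
proof -
  have "norm (U t - U s) \<le> B * measure lborel (cbox s t)"
    by (rule has_integral_bound[OF B_nonneg propagator_diff[OF assms, folded box_real(2)]])
      (use assms a_le U_unitary in \<open>simp add: norm_unitary_right\<close>)
  then show ?thesis using assms by simp
qed

lemma a_has_integral:
  assumes "0 \<le> s" "s \<le> t" "t \<le> T"
  shows "(a has_integral integral {s..t} a) {s..t}"
  using assms by (intro integrable_integral integrable_on_subinterval[OF a_int]) auto

lemma norm_integral_a_le:
  assumes "0 \<le> s" "s \<le> t" "t \<le> T"
  shows "norm (integral {s..t} a) \<le> B * (t - s)"
proof -
  have "norm (integral {s..t} a) \<le> B * measure lborel (cbox s t)"
  proof (rule has_integral_bound[OF B_nonneg])
    show "(a has_integral integral {s..t} a) (cbox s t)"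
      using a_has_integral[OF assms] by simp
  qed (use assms a_le in simp)
  then show ?thesis using assms by simp
qed

lemma integral_a_mem:
  assumes "0 \<le> s" "s \<le> t" "t \<le> T"
  shows "integral {s..t} a \<in> L"
  by (rule has_integral_subspace[OF subspace a_has_integral[OF assms]]) (use assms a_mem in auto)

text \<open>Two errors of size \<open>(B * (t - s))\<^sup>2\<close> add up: freezing
  \<open>U\<close> at time \<open>s\<close> under the integral, and truncating the exponential after
  its linear term.\<close>

lemma propagator_step:
  assumes "0 \<le> s" "s \<le> t" "t \<le> T"
  shows "norm (U t - mexp (integral {s..t} a) ** U s) \<le> 2 * (B * (t - s))\<^sup>2"
proof -
  define I where "I = integral {s..t} a"
  have Us: "unitary (U s)" using assms U_unitary by simp
  have "((\<lambda>u. a u ** U u - a u ** U s) has_integral (U t - U s) - I ** U s) (cbox s t)"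
    using has_integral_diff[OF propagator_diff[OF assms]
        has_integral_linear[OF a_has_integral[OF assms] mm.bounded_linear_left[of "U s"]]]
    by (simp add: o_def I_def)
  moreover have "norm (a u ** U u - a u ** U s) \<le> B * (B * (t - s))" if "u \<in> cbox s t" for u
  proof -
    have "norm (U u - U s) \<le> B * (u - s)"
      using that assms by (intro norm_propagator_diff_le) auto
    also have "\<dots> \<le> B * (t - s)" using that B_nonneg by (intro mult_left_mono) auto
    finally have "norm (a u) * norm (U u - U s) \<le> B * (B * (t - s))"
      using that assms B_nonneg by (intro mult_mono a_le) auto
    then show ?thesis
      unfolding mm.diff_right[symmetric] by (rule order_trans[OF norm_matrix_mult_le])
  qed
  ultimately have "norm ((U t - U s) - I ** U s) \<le> B * (B * (t - s)) * measure lborel (cbox s t)"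
    using B_nonneg assms by (intro has_integral_bound) auto
  then have 1: "norm ((U t - U s) - I ** U s) \<le> (B * (t - s))\<^sup>2"
    using assms by (simp add: power2_eq_square mult_ac)
  have "norm ((mexp I - mat 1 - I) ** U s) = norm (mexp I - mat 1 - I)"
    by (rule norm_unitary_right[OF Us])
  also have "\<dots> \<le> (norm I)\<^sup>2"
    unfolding I_def by (intro mexp_approx_one skew_mem integral_a_mem assms)
  also have "\<dots> \<le> (B * (t - s))\<^sup>2"
    unfolding I_def by (intro power_mono norm_integral_a_le assms) auto
  finally have 2: "norm ((mexp I - mat 1 - I) ** U s) \<le> (B * (t - s))\<^sup>2" .
  have "U t - mexp I ** U s = ((U t - U s) - I ** U s) - (mexp I - mat 1 - I) ** U s"
    by (simp add: mm.diff_left)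
  then have "norm (U t - mexp I ** U s) \<le> norm ((U t - U s) - I ** U s) + norm ((mexp I - mat 1 - I) ** U s)"
    by (metis norm_triangle_ineq4)
  with 1 2 show ?thesis unfolding I_def by simp
qed

lemma propagator_approx:
  assumes e: "e > 0"
  shows "\<exists>C\<in>L. norm C \<le> integral {0..T} (\<lambda>t. norm (a t)) + e \<and> norm (mexp C - U T) \<le> 2 * e"
proof -
  define l where "l = integral {0..T} (\<lambda>t. norm (a t))"
  have l0: "l \<ge> 0" unfolding l_def by (rule integral_nonneg[OF norm_a_int]) simp
  \<comment> \<open>The first summand keeps the accumulated discretisation error below
    \<open>e\<close>; the second keeps a weight, at most \<open>(B * T + e) / real n\<close>, times
    the total weight, at most \<open>l + e\<close>, below \<open>1 / 4\<close>.\<close>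
  obtain n :: nat where n: "2 * (B * T)\<^sup>2 / e + 4 * (B * T + e) * (l + e) < real n"
    using reals_Archimedean2 by blast
  have pos: "2 * (B * T)\<^sup>2 / e \<ge> 0" "4 * (B * T + e) * (l + e) \<ge> 0"
    using e T B_nonneg l0 by auto
  with n have n0: "real n > 0" by linarith
  have n1: "2 * (B * T)\<^sup>2 / real n \<le> e"
  proof -
    have "2 * (B * T)\<^sup>2 / e \<le> real n" using n pos by linarith
    then show ?thesis using e n0 by (simp add: field_simps)
  qed
  have n2: "(B * T + e) / real n * (l + e) < 1 / 4"
  proof -
    have "4 * (B * T + e) * (l + e) < real n" using n pos by linarith
    then show ?thesis using n0 by (simp add: field_simps)
  qed
  define \<tau> where "\<tau> k = real k * (T / real n)" for k
  have \<tau>: "0 \<le> \<tau> k" "\<tau> k \<le> \<tau> (Suc k)" "\<tau> (Suc k) - \<tau> k = T / real n" for k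
    using T n0 by (auto simp: \<tau>_def distrib_right add_divide_distrib)
  have \<tau>0: "\<tau> 0 = 0" and \<tau>n: "\<tau> n = T" using n0 by (simp_all add: \<tau>_def)
  have \<tau>T: "\<tau> k \<le> T" if "k \<le> n" for k
    using that \<tau>n lift_Suc_mono_le[of \<tau> k n] \<tau>(2) by auto
  define I where "I k = integral {\<tau> k..\<tau> (Suc k)} a" for k
  \<comment> \<open>The added \<open>e / real n\<close> keeps the weight positive even if
    \<open>I k = 0\<close>, and raises the total by \<open>e\<close>.\<close>
  define w where "w k = norm (I k) + e / real n" for k
  define X where "X k = (1 / w k) *\<^sub>R I k" for k
  have w0: "w k > 0" for k
    unfolding w_def using e n0 by (simp add: add_nonneg_pos)
  have wX: "w k *\<^sub>R X k = I k" for k using w0[of k] by (simp add: X_def)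
  have I_le: "norm (I k) \<le> B * T / real n" if "k < n" for k
    using norm_integral_a_le[OF \<tau>(1,2), of k] \<tau>T[of "Suc k"] \<tau>(3)[of k] that by (simp add: I_def)
  have X_mem: "X k \<in> L" if "k < n" for k
    unfolding X_def I_def using \<tau>T[of "Suc k"] that by (intro scaleR_mem integral_a_mem \<tau>) simp
  have X_le: "norm (X k) \<le> 1" for k
    using w0[of k] e n0 by (simp add: X_def) (simp add: w_def)
  have "(\<Sum>j<k. norm (I j)) \<le> integral {0..\<tau> k} (\<lambda>t. norm (a t))" if "k \<le> n" for k
    using that
  proof (induction k)
    case 0
    then show ?case by (simp add: \<tau>0)
  next
    case (Suc k)
    have int: "(\<lambda>t. norm (a t)) integrable_on {0..\<tau> (Suc k)}"
      by (rule integrable_on_subinterval[OF norm_a_int]) (use \<tau>T[OF Suc.prems] in auto)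
    have "norm (I k) \<le> integral {\<tau> k..\<tau> (Suc k)} (\<lambda>t. norm (a t))"
      unfolding I_def
    proof (rule integral_norm_bound_integral)
      show "a integrable_on {\<tau> k..\<tau> (Suc k)}"
        using a_has_integral[OF \<tau>(1,2) \<tau>T[OF Suc.prems]] by blast
      show "(\<lambda>t. norm (a t)) integrable_on {\<tau> k..\<tau> (Suc k)}"
        by (rule integrable_on_subinterval[OF int]) (use \<tau>(1) in auto)
    qed simp
    with Suc Henstock_Kurzweil_Integration.integral_combine[OF \<tau>(1,2) int] show ?case by simp
  qed
  from this[of n] have "(\<Sum>j<n. norm (I j)) \<le> l" by (simp add: \<tau>n l_def)
  moreover have "(\<Sum>j<n. w j) = (\<Sum>j<n. norm (I j)) + e"
    using n0 by (simp add: w_def sum.distrib)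
  ultimately have W: "(\<Sum>j<n. w j) \<le> l + e" by simp
  have small: "w k * (\<Sum>j<n. w j) < 1 / 4" if "k < n" for k
  proof -
    have "w k \<le> (B * T + e) / real n"
      using I_le[OF that] by (simp add: w_def add_divide_distrib)
    then have "w k * (\<Sum>j<n. w j) \<le> (B * T + e) / real n * (l + e)"
      using w0 W e T B_nonneg by (intro mult_mono sum_nonneg) (auto simp: less_imp_le)
    then show ?thesis using n2 by (rule le_less_trans)
  qed
  \<comment> \<open>Chosen so that \<open>K\<close> times the squared error being at most
    \<open>l + e\<close> forces the error to be at most \<open>e\<close>.\<close>
  define K where "K = (l + e) / e\<^sup>2"
  have K: "K > 0" using l0 e by (simp add: K_def)
  obtain C where C: "C \<in> L" "norm C \<le> (\<Sum>i<n. w i)" "K * (norm (mexp C - texp w X n))\<^sup>2 \<le> (\<Sum>i<n. w i)"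
    using word_shortening[of n w X K] w0 X_mem X_le small K by blast
  have "K * (norm (mexp C - texp w X n))\<^sup>2 \<le> K * e\<^sup>2"
    using C(3) W e by (simp add: K_def)
  then have "(norm (mexp C - texp w X n))\<^sup>2 \<le> e\<^sup>2" using K by simp
  then have C1: "norm (mexp C - texp w X n) \<le> e" using e power2_le_imp_le less_imp_le by blast
  \<comment> \<open>Left multiplication by a unitary exponential preserves the error made so far, so
    the one-step errors simply add.\<close>
  have "norm (U (\<tau> k) - texp w X k) \<le> real k * (2 * (B * (T / real n))\<^sup>2)" if "k \<le> n" for k
    using that
  proof (induction k)
    case 0
    have "U 0 = mat 1" using integral_unique[OF U_int[of 0]] T by simp
    then show ?case by (simp add: \<tau>0)
  next
    case (Suc k)
    have "skew (I k)" unfolding I_def by (intro skew_mem integral_a_mem \<tau> \<tau>T Suc)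
    then have "norm (mexp (I k) ** (U (\<tau> k) - texp w X k)) = norm (U (\<tau> k) - texp w X k)"
      by (intro norm_unitary_left unitary_mexp)
    moreover have "norm (U (\<tau> (Suc k)) - mexp (I k) ** U (\<tau> k)) \<le> 2 * (B * (T / real n))\<^sup>2"
      using propagator_step[OF \<tau>(1,2) \<tau>T[OF Suc.prems]] unfolding I_def \<tau>(3) .
    moreover have "U (\<tau> (Suc k)) - texp w X (Suc k)
        = (U (\<tau> (Suc k)) - mexp (I k) ** U (\<tau> k)) + mexp (I k) ** (U (\<tau> k) - texp w X k)"
      by (simp add: wX mm.diff_right)
    then have "norm (U (\<tau> (Suc k)) - texp w X (Suc k))
        \<le> norm (U (\<tau> (Suc k)) - mexp (I k) ** U (\<tau> k)) + norm (mexp (I k) ** (U (\<tau> k) - texp w X k))"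
      by (metis norm_triangle_ineq)
    ultimately show ?case using Suc by (simp add: distrib_right)
  qed
  from this[of n] have "norm (U T - texp w X n) \<le> real n * (2 * (B * (T / real n))\<^sup>2)"
    by (simp add: \<tau>n)
  also have "\<dots> = 2 * (B * T)\<^sup>2 / real n" using n0 by (simp add: power2_eq_square)
  finally have "norm (texp w X n - U T) \<le> e" using n1 by (simp add: norm_minus_commute)
  with C1 have "norm (mexp C - U T) \<le> 2 * e"
    using norm_diff_triangle_le[of "mexp C" "texp w X n" e "U T" e] by simp
  with C(1,2) W show ?thesis unfolding l_def by (intro bexI[of _ C]) auto
qed

text \<open>The approximate exponents are bounded, so a subsequence converges. Its limit stays in
  \<open>L\<close>, a closed subspace, and continuity of \<open>mexp\<close> on skew matrices turns
  approximation into equality.\<close>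

lemma propagator_eq_mexp:
  "\<exists>C\<in>L. mexp C = U T \<and> norm C \<le> integral {0..T} (\<lambda>t. norm (a t))"
proof -
  define l where "l = integral {0..T} (\<lambda>t. norm (a t))"
  have "\<exists>C. C \<in> L \<and> norm C \<le> l + 1 / real (Suc m) \<and> norm (mexp C - U T) \<le> 2 * (1 / real (Suc m))" for m
    using propagator_approx[of "1 / real (Suc m)"] unfolding l_def by auto
  then obtain C where C: "\<And>m. C m \<in> L" "\<And>m. norm (C m) \<le> l + 1 / real (Suc m)"
      "\<And>m. norm (mexp (C m) - U T) \<le> 2 * (1 / real (Suc m))"
    by metis
  have "bounded (range C)"
    by (rule boundedI[of _ "l + 1"]) (auto intro!: order_trans[OF C(2)])
  then obtain D r where r: "strict_mono r" "(C \<circ> r) \<longlonglongrightarrow> D"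
    using bounded_imp_convergent_subsequence by blast
  have null: "(\<lambda>m. 1 / real (Suc (r m))) \<longlonglongrightarrow> 0"
    using LIMSEQ_subseq_LIMSEQ[OF LIMSEQ_inverse_real_of_nat r(1)] by (simp add: o_def inverse_eq_divide)
  have D: "D \<in> L"
    using closed_sequentially[OF closed_subspace[OF subspace] _ r(2)] C(1) by simp
  have "norm D \<le> l"
  proof (rule LIMSEQ_le)
    show "(\<lambda>m. norm ((C \<circ> r) m)) \<longlonglongrightarrow> norm D" by (rule tendsto_norm[OF r(2)])
    show "(\<lambda>m. l + 1 / real (Suc (r m))) \<longlonglongrightarrow> l" using tendsto_add[OF tendsto_const null] by simp
  qed (use C(2) in auto)
  moreover have "mexp D = U T"
  proof (rule LIMSEQ_unique)
    show "(\<lambda>m. mexp ((C \<circ> r) m)) \<longlonglongrightarrow> mexp D"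
      using continuous_on_mexp[OF skew_mem] D C(1) r(2)
      by (auto simp: continuous_on_sequentially o_def)
    have "(\<lambda>m. 2 * (1 / real (Suc (r m)))) \<longlonglongrightarrow> 0" using tendsto_mult_left[OF null, of 2] by simp
    then have "(\<lambda>m. mexp ((C \<circ> r) m) - U T) \<longlonglongrightarrow> 0"
      by (rule Lim_null_comparison[rotated]) (use C(3) in \<open>simp add: always_eventually\<close>)
    then show "(\<lambda>m. mexp ((C \<circ> r) m)) \<longlonglongrightarrow> U T" by (simp add: LIM_zero_iff)
  qed
  ultimately show ?thesis using D unfolding l_def by blast
qed

end

end

section \<open>The dynamical Lie algebra\<close>

lemma adj_cscale: "adj (cscale c A) = cscale (cnj c) (adj A)"
  by (simp add: adj_def cscale_def vec_eq_iff)

lemma cscale_cscale: "cscale c (cscale d A) = cscale (c * d) A"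
  by (simp add: cscale_def vec_eq_iff)

lemma cscale_minus_left: "cscale (- c) A = - cscale c A"
  by (simp add: cscale_def vec_eq_iff)

lemma cscale_one [simp]: "cscale 1 A = A"
  by (simp add: cscale_def)

lemma cscale_scaleR: "cscale c (r *\<^sub>R A) = r *\<^sub>R cscale c A"
  by (simp add: cscale_def vec_eq_iff)

lemma cscale_add: "cscale c (A + B) = cscale c A + cscale c B"
  by (simp add: cscale_def vec_eq_iff distrib_left)

lemma cscale_matrix_mult: "cscale c A ** B = cscale c (A ** B)"
  by (simp add: cscale_def vec_eq_iff matrix_matrix_mult_def sum_distrib_left mult.assoc)

lemma bounded_linear_cscale: "bounded_linear (cscale c :: ('n::finite) cmat \<Rightarrow> _)"
  by (intro linearI cscale_add cscale_scaleR linear_conv_bounded_linear[THEN iffD1])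

lemma norm_cscale:
  fixes A :: "('n::finite) cmat"
  assumes "cmod c = 1" shows "norm (cscale c A) = norm A"
  unfolding norm_vec_def cscale_def L2_set_def by (simp add: norm_mult assms)

text \<open>Skew-Hermitian matrices form a real Lie algebra, so skewness passes from the generators
  to all of \<open>dla S\<close>.\<close>

lemma skew_lie_algebra_dla:
  assumes "\<And>X. X \<in> S \<Longrightarrow> skew X"
  shows "skew_lie_algebra (dla S)"
proof
  show "subspace (dla S)"
    by (rule subspaceI) (auto intro: dla.intros)
  show "skew X" if "X \<in> dla S" for X
    using that
  proof induction
    case (bracket X Y)
    then show ?case
      by (simp add: skew_def commutator_def adj_matrix_mult mm.minus_left mm.minus_right
          linear_diff[OF bounded_linear.linear[OF bounded_linear_adj]])
  qed (auto simp: assms skew_add skew_scaleR, simp add: skew_def)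
qed (rule dla.bracket)

text \<open>Off a finite, hence null, set the function is continuous and so measurable; it is
  dominated by a constant, and restoring the null set preserves integrability.\<close>

lemma piecewise_continuous_integrable:
  fixes f :: "real \<Rightarrow> 'a::euclidean_space"
  assumes pc: "piecewise_continuous_nonneg f" and T: "T \<ge> 0"
    and bound: "\<And>t. t \<in> {0..T} \<Longrightarrow> norm (f t) \<le> B"
  shows "f absolutely_integrable_on {0..T}"
proof -
  obtain S where S: "finite S" "continuous_on ({0..T} - S) f"
    using pc T unfolding piecewise_continuous_nonneg_def by blast
  have "negligible S" using S(1) by (rule negligible_finite)
  have "f absolutely_integrable_on ({0..T} - S)"
  proof (rule measurable_bounded_by_integrable_imp_absolutely_integrable)
    show "f \<in> borel_measurable (lebesgue_on ({0..T} - S))"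
      using S by (intro continuous_imp_measurable_on_sets_lebesgue)
        (auto intro!: sets.Diff simp: negligible_imp_sets \<open>negligible S\<close>)
    show "({0..T} - S) \<in> sets lebesgue"
      by (auto intro!: sets.Diff simp: negligible_imp_sets \<open>negligible S\<close>)
    have "(\<lambda>_. B) integrable_on {0..T}" by (rule integrable_const_ivl)
    then show "(\<lambda>_. B) integrable_on ({0..T} - S)"
      by (rule integrable_spike_set) (auto intro: negligible_subset[OF \<open>negligible S\<close>])
  qed (use bound in auto)
  then show ?thesis
    by (rule absolutely_integrable_spike_set) (auto intro: negligible_subset[OF \<open>negligible S\<close>])
qed

theorem theorem1:
  fixes Hs :: "nat \<Rightarrow> ('n::finite) cmat"
    and h :: "nat \<Rightarrow> real \<Rightarrow> real"
    and M :: nat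
    and H U :: "real \<Rightarrow> 'n cmat"
  assumes herm: "\<forall>m\<le>M. hermitian (Hs m)"
    and bdd: "\<forall>m\<le>M. \<exists>B. \<forall>t\<ge>0. \<bar>h m t\<bar> \<le> B"
    and H_def: "\<forall>t. H t = (\<Sum>m\<le>M. h m t *\<^sub>R Hs m)"
    and pwc: "piecewise_continuous_nonneg H"
    and U_int: "\<forall>t\<ge>0. (\<lambda>s. H s ** U s) integrable_on {0..t}"
    and U_sol: "\<forall>t\<ge>0. U t = mat 1 - cscale \<i> (integral {0..t} (\<lambda>s. H s ** U s))"
    and U_unitary: "\<forall>t\<ge>0. adj (U t) ** U t = mat 1"
  shows "\<forall>T\<ge>0. \<exists>C. hermitian C \<and> mexp (cscale (-\<i>) C) = U T
           \<and> cscale \<i> C \<in> dla {cscale \<i> (Hs m) | m. m \<le> M}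
           \<and> frob C \<le> integral {0..T} (\<lambda>t. frob (H t))"
proof (intro allI impI)
  fix T :: real assume T: "T \<ge> 0"
  define L where "L = dla {cscale \<i> (Hs m) | m. m \<le> M}"
  interpret skew_lie_algebra L
    unfolding L_def
    by (rule skew_lie_algebra_dla)
      (use herm in \<open>auto simp: skew_def hermitian_def adj_cscale cscale_minus_left\<close>)
  define a where "a t = cscale (-\<i>) (H t)" for t
  have norm_a: "norm (a t) = norm (H t)" for t by (simp add: a_def norm_cscale)
  have a_mem: "a t \<in> L" for t
  proof -
    \<comment> \<open>The generators carry \<open>+i\<close>, so the minus sign is absorbed into the
      real coefficients.\<close>
    have "a t = (\<Sum>m\<le>M. - h m t *\<^sub>R cscale \<i> (Hs m))"
      unfolding a_def using H_def
      by (simp add: bounded_linear.linear[OF bounded_linear_cscale, THEN linear_sum]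
          cscale_scaleR cscale_minus_left sum_negf)
    also have "\<dots> \<in> L"
      by (intro subspace_sum[OF subspace] scaleR_mem) (auto simp: L_def intro: dla.gen)
    finally show ?thesis .
  qed
  obtain b where b: "\<And>m t. m \<le> M \<Longrightarrow> t \<ge> 0 \<Longrightarrow> \<bar>h m t\<bar> \<le> b m"
    using bdd by metis
  define B where "B = (\<Sum>m\<le>M. b m * norm (Hs m))"
  have H_le: "norm (H t) \<le> B" if "t \<in> {0..T}" for t
    using H_def that b unfolding B_def
    by (auto intro!: sum_norm_le mult_right_mono)
  have H_int: "H absolutely_integrable_on {0..T}"
    by (rule piecewise_continuous_integrable[OF pwc T H_le])
  have "\<exists>Y\<in>L. mexp Y = U T \<and> norm Y \<le> integral {0..T} (\<lambda>t. norm (a t))"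
  proof (rule propagator_eq_mexp[OF T a_mem])
    show "norm (a t) \<le> B" if "t \<in> {0..T}" for t using H_le[OF that] by (simp add: norm_a)
    have "H integrable_on {0..T}" using H_int by (rule set_lebesgue_integral_eq_integral(1))
    from integrable_linear[OF this bounded_linear_cscale[of "-\<i>"]]
    show "a integrable_on {0..T}" by (simp add: o_def a_def[abs_def])
    show "(\<lambda>t. norm (a t)) integrable_on {0..T}"
      unfolding norm_a using H_int by (simp add: absolutely_integrable_on_def)
    show "((\<lambda>s. a s ** U s) has_integral (U t - mat 1)) {0..t}" if "t \<in> {0..T}" for t
    proof -
      have "((\<lambda>s. cscale (-\<i>) (H s ** U s)) has_integral cscale (-\<i>) (integral {0..t} (\<lambda>s. H s ** U s))) {0..t}"
        using has_integral_linear[OF integrable_integral bounded_linear_cscale] U_int that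
        by (fastforce simp: o_def)
      moreover have "U t - mat 1 = cscale (-\<i>) (integral {0..t} (\<lambda>s. H s ** U s))"
        using U_sol that by (simp add: cscale_minus_left)
      ultimately show ?thesis unfolding a_def cscale_matrix_mult by simp
    qed
    show "unitary (U t)" if "t \<in> {0..T}" for t
      using U_unitary that by (simp add: unitary_def)
  qed
  then obtain Y where Y: "Y \<in> L" "mexp Y = U T" "norm Y \<le> integral {0..T} (\<lambda>t. norm (H t))"
    unfolding norm_a by blast
  \<comment> \<open>The witness is \<open>C = cscale \<i> Y\<close>: then \<open>-i\<close> times
    \<open>C\<close> is \<open>Y\<close>, while \<open>i\<close> times \<open>C\<close> is
    \<open>- Y\<close>, still in \<open>L\<close>.\<close>
  have "hermitian (cscale \<i> Y)"
    using skew_mem[OF Y(1)] unfolding skew_def hermitian_def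
    by (simp add: adj_cscale) (simp add: cscale_def vec_eq_iff)
  moreover have "cscale (-\<i>) (cscale \<i> Y) = Y" by (simp add: cscale_cscale)
  moreover have "cscale \<i> (cscale \<i> Y) \<in> L"
    using scaleR_mem[OF Y(1), of "-1"] by (simp add: cscale_cscale cscale_minus_left)
  moreover have "frob (cscale \<i> Y) \<le> integral {0..T} (\<lambda>t. frob (H t))"
    using Y(3) by (simp add: frob_eq_norm norm_cscale)
  ultimately show "\<exists>C. hermitian C \<and> mexp (cscale (-\<i>) C) = U T
      \<and> cscale \<i> C \<in> dla {cscale \<i> (Hs m) | m. m \<le> M}
      \<and> frob C \<le> integral {0..T} (\<lambda>t. frob (H t))"
    using Y(2) unfolding L_def by (intro exI[of _ "cscale \<i> Y"]) simp
qed

end
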